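(* Let $X\subseteq\mathscr{A}^\infty$ be a shift space over a finite alphabet $\mathscr{A}$, and let $X^+$ be its measure center. If $X^+$ has the $\bar d$-shadowing property, then $X$ has the $\bar d$-shadowing property.
   Context: Alphabet: $\mathscr{A}$ is a finite set with at least two elements. $\mathscr{A}^\infty$ is the set of sequences $x=(x_i)_{i\ge 0}$ with entries in $\mathscr{A}$, with the product topology; $\sigma(x)_j=x_{j+1}$. A shift space is a nonempty closed set $X\subseteq\mathscr{A}^\infty$ with $\sigma(X)\subseteq X$. $\mathcal{B}(X)$ is the set of all finite words appearing in elements of $X$. $\mathcal{M}_\sigma(X)$ is the set of $\sigma$-invariant Borel probability measures concentrated on $X$. Measure center $X^+$: the smallest shift space $X^+\subseteq X$ such that $\mu(X^+)=1$ for every $\mu\in\mathcal{M}_\sigma(X)$. $\bar d(x,y)=\limsup_{n\to\infty}\frac1n|\{0\le j<n: x_j\ne y_j\}|$ for $x,y\in\mathscr{A}^\infty$. $\bar d$-shadowing property of a shift space $X$: for every $\varepsilon>0$ there is $N\in\mathbb{N}$ such that for every sequence $(w^{(j)})_{j=1}^\infty$ of words in $\mathcal{B}(X)$ with $|w^{(j)}|\ge N$ for all $j$, there is $x'\in X$ with $\bar d(w^{(1)}w^{(2)}w^{(3)}\ldots,x')<\varepsilon$. *)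

theory Defs
  imports "HOL-Probability.Probability"
begin

text \<open>
  The alphabet is a type of sorts \<open>finite\<close> and \<open>discrete_topology\<close>, so that the topology of
  \<open>nat \<Rightarrow> 'a\<close> is the product of discrete topologies and \<open>borel\<close> is its Borel
  sigma-algebra.
\<close>

definition shift_map :: "(nat \<Rightarrow> 'a) \<Rightarrow> nat \<Rightarrow> 'a" where
  "shift_map x = (\<lambda>j. x (Suc j))"

definition shift_space :: "(nat \<Rightarrow> 'a::{finite, discrete_topology}) set \<Rightarrow> bool" where
  "shift_space X \<longleftrightarrow> X \<noteq> {} \<and> closed X \<and> shift_map ` X \<subseteq> X"

definition language :: "(nat \<Rightarrow> 'a) set \<Rightarrow> 'a list set" where
  "language X = {map x [i..<i + n] | x i n. x \<in> X}"

definition invariant_measures ::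
  "(nat \<Rightarrow> 'a::{finite, discrete_topology}) set \<Rightarrow> (nat \<Rightarrow> 'a) measure set" where
  "invariant_measures X =
     {\<mu>. prob_space \<mu> \<and> sets \<mu> = sets borel \<and> distr \<mu> borel shift_map = \<mu> \<and> emeasure \<mu> X = 1}"

definition full_measure_subshift ::
  "(nat \<Rightarrow> 'a::{finite, discrete_topology}) set \<Rightarrow> (nat \<Rightarrow> 'a) set \<Rightarrow> bool" where
  "full_measure_subshift X Y \<longleftrightarrow>
     shift_space Y \<and> Y \<subseteq> X \<and> (\<forall>\<mu>\<in>invariant_measures X. emeasure \<mu> Y = 1)"

definition is_measure_center ::
  "(nat \<Rightarrow> 'a::{finite, discrete_topology}) set \<Rightarrow> (nat \<Rightarrow> 'a) set \<Rightarrow> bool" where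
  "is_measure_center X Y \<longleftrightarrow>
     full_measure_subshift X Y \<and> (\<forall>Z. full_measure_subshift X Z \<longrightarrow> Y \<subseteq> Z)"

text \<open>The term for \<open>n = 0\<close> is \<open>0 / 0 = 0\<close> and does not affect the upper limit.\<close>

definition dbar :: "(nat \<Rightarrow> 'a) \<Rightarrow> (nat \<Rightarrow> 'a) \<Rightarrow> ereal" where
  "dbar x y = limsup (\<lambda>n. ereal (real (card {j. j < n \<and> x j \<noteq> y j}) / real n))"

text \<open>
  The infinite concatenation of nonempty words, indexed from 0. The first \<open>i + 1\<close> words have
  total length greater than \<open>i\<close>, so they determine the symbol at position \<open>i\<close>.
\<close>

definition inf_concat :: "(nat \<Rightarrow> 'a list) \<Rightarrow> nat \<Rightarrow> 'a" where
  "inf_concat w = (\<lambda>i. concat (map w [0..<Suc i]) ! i)"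

text \<open>
  The bound \<open>N\<close> is taken positive so that the infinite concatenation is well defined; enlarging
  \<open>N\<close> only restricts the sequences of words considered.
\<close>

definition dbar_shadowing :: "(nat \<Rightarrow> 'a) set \<Rightarrow> bool" where
  "dbar_shadowing X \<longleftrightarrow>
     (\<forall>\<epsilon>::real. \<epsilon> > 0 \<longrightarrow>
       (\<exists>N::nat. N > 0 \<and>
         (\<forall>w. (\<forall>j. w j \<in> language X \<and> length (w j) \<ge> N) \<longrightarrow>
            (\<exists>x'\<in>X. dbar (inf_concat w) x' < ereal \<epsilon>))))"

end

theory Submission
  imports Defs
begin

text \<open>
  Let \<open>Y\<close> be the measure center of \<open>X\<close>; every invariant measure of \<open>X\<close> is carried by \<open>Y\<close>. A block
  of length \<open>m\<close> that does not occur in \<open>Y\<close> defines a cylinder disjoint from \<open>Y\<close>, hence null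
  for all invariant measures of \<open>X\<close>. Such foreign blocks must therefore have small frequency in all
  sufficiently long words of \<open>X\<close>, uniformly: otherwise empirical measures along
  longer and longer words would accumulate at an invariant measure charging these cylinders
  (\<open>empirical_limit_measure\<close>, \<open>uniformly_rare_visits\<close>). Accumulation points are found by Tychonoff's
  theorem as finitely additive set functions; compactness of the sequence space makes them
  countably additive on clopen sets, and Caratheodory's theorem turns them into measures.

  Now fix the length \<open>m\<close> that shadowing in \<open>Y\<close> requires for the error \<open>\<epsilon> / 2\<close>. A long word of \<open>X\<close>
  is cut into pieces of length between \<open>m\<close> and \<open>2 * m\<close>, and the pieces that are foreign to \<open>Y\<close>
  are overwritten by words of \<open>Y\<close>. Pieces of length exactly \<open>m\<close> are rarely foreign, and each word has
  at most one piece of another length, so this changes a small proportion of the symbols. Thus a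
  concatenation of long words of \<open>X\<close> is within \<open>\<epsilon> / 2\<close> of a concatenation of
  words of \<open>Y\<close> of length at least \<open>m\<close> (\<open>approximate_by_subshift_blocks\<close>). The latter is shadowed
  in \<open>Y\<close>, which is contained in \<open>X\<close>, and the triangle inequality for the distance finishes the proof.
\<close>

section \<open>The clopen algebra of the sequence space\<close>

lemma compact_UNIV_sequences: "compact (UNIV :: (nat \<Rightarrow> 'a::{finite, discrete_topology}) set)"
proof -
  have "compactin (product_topology (\<lambda>_. euclidean) UNIV) (PiE (UNIV::nat set) (\<lambda>_. UNIV :: 'a set))"
    by (subst compactin_PiE) (auto intro: finite_imp_compact)
  then show ?thesis
    by (simp add: euclidean_product_topology)
qed

definition cylinder :: "'a list \<Rightarrow> (nat \<Rightarrow> 'a) set" where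
  "cylinder l = {y. map y [0..<length l] = l}"

lemma clopen_prefix_condition:
  fixes W :: "'a::{finite, discrete_topology} list set"
  shows "open {y::nat \<Rightarrow> 'a. map y [0..<m] \<in> W}" "closed {y::nat \<Rightarrow> 'a. map y [0..<m] \<in> W}"
proof -
  have op: "open {y::nat \<Rightarrow> 'a. map y [0..<m] \<in> W}" for W :: "'a list set"
  proof -
    have "open {y::nat \<Rightarrow> 'a. map y [0..<m] = l}" for l
    proof (cases "length l = m")
      case True
      have "{y::nat \<Rightarrow> 'a. map y [0..<m] = l} = {y. \<forall>i\<in>{..<m}. y i \<in> {l ! i}}"
        using True by (auto simp: list_eq_iff_nth_eq)
      also have "open \<dots>"
        by (rule product_topology_basis'[where x = "\<lambda>i. i"]) (auto intro: Topological_Spaces.open_discrete)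
      finally show ?thesis .
    next
      case False
      then have "{y::nat \<Rightarrow> 'a. map y [0..<m] = l} = {}" by auto
      then show ?thesis by simp
    qed
    moreover have "{y::nat \<Rightarrow> 'a. map y [0..<m] \<in> W} = (\<Union>l\<in>W. {y. map y [0..<m] = l})" by auto
    ultimately show ?thesis by auto
  qed
  show "open {y::nat \<Rightarrow> 'a. map y [0..<m] \<in> W}" by (rule op)
  have "- {y::nat \<Rightarrow> 'a. map y [0..<m] \<in> W} = {y. map y [0..<m] \<in> -W}" by auto
  with op[of "-W"] show "closed {y::nat \<Rightarrow> 'a. map y [0..<m] \<in> W}" by (simp add: closed_def)
qed

lemma clopen_cylinder:
  "open (cylinder l)" "closed (cylinder (l :: 'a::{finite, discrete_topology} list))"
  using clopen_prefix_condition[of "length l" "{l}"] by (auto simp: cylinder_def)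

lemma open_contains_cylinder:
  fixes U :: "(nat \<Rightarrow> 'a::{finite, discrete_topology}) set"
  assumes "open U" "x \<in> U"
  shows "\<exists>n. cylinder (map x [0..<n]) \<subseteq> U"
proof -
  have "openin (product_topology (\<lambda>_. euclidean) UNIV) U"
    using assms by (simp add: euclidean_product_topology)
  from product_topology_open_contains_basis[OF this \<open>x \<in> U\<close>]
  obtain V where V: "x \<in> PiE UNIV V" "finite {i. V i \<noteq> UNIV}" "PiE UNIV V \<subseteq> U" by auto
  from V(2) obtain n where n: "\<And>i. V i \<noteq> UNIV \<Longrightarrow> i < n"
    unfolding finite_nat_set_iff_bounded by auto
  have "cylinder (map x [0..<n]) \<subseteq> PiE UNIV V"
  proof
    fix y assume y: "y \<in> cylinder (map x [0..<n])"
    then have eq: "y i = x i" if "i < n" for i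
      using that by (auto simp: cylinder_def)
    have "y i \<in> V i" for i
      using V(1) n[of i] eq[of i] by (cases "i < n") auto
    then show "y \<in> PiE UNIV V" by auto
  qed
  with V(3) show ?thesis by blast
qed

text \<open>
  Since there are only countably many cylinders, this exhibits every open set as a countable union
  of clopen sets.
\<close>
lemma open_eq_Union_cylinders:
  fixes U :: "(nat \<Rightarrow> 'a::{finite, discrete_topology}) set"
  assumes "open U"
  shows "U = (\<Union>l\<in>{l. cylinder l \<subseteq> U}. cylinder l)"
proof -
  have "x \<in> cylinder (map x [0..<n])" for x :: "nat \<Rightarrow> 'a" and n by (simp add: cylinder_def)
  then show ?thesis using open_contains_cylinder[OF assms] by blast
qed

abbreviation clopens :: "(nat \<Rightarrow> 'a::{finite, discrete_topology}) set set" where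
  "clopens \<equiv> {C. open C \<and> closed C}"

lemma sets_borel_eq_clopens:
  "sets (borel :: (nat \<Rightarrow> 'a::{finite, discrete_topology}) measure) = sigma_sets UNIV clopens"
proof
  have "U \<in> sigma_sets UNIV clopens" if "open U" for U :: "(nat \<Rightarrow> 'a) set"
  proof -
    interpret sigma_algebra UNIV "sigma_sets UNIV (clopens :: (nat \<Rightarrow> 'a) set set)"
      by (rule sigma_algebra_sigma_sets) simp
    have "(\<Union>l\<in>{l. cylinder l \<subseteq> U}. cylinder l) \<in> sigma_sets UNIV clopens"
      by (rule countable_UN') (auto simp: clopen_cylinder)
    then show ?thesis using open_eq_Union_cylinders[OF that] by simp
  qed
  then show "sets (borel :: (nat \<Rightarrow> 'a) measure) \<subseteq> sigma_sets UNIV clopens"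
    unfolding borel_def by (auto intro!: sigma_sets_mono simp: sets_measure_of)
  show "sigma_sets UNIV clopens \<subseteq> sets (borel :: (nat \<Rightarrow> 'a) measure)"
    unfolding borel_def by (auto intro!: sigma_sets_mono' simp: sets_measure_of)
qed

text \<open>
  On a compact space a finitely additive content on the clopen sets is automatically countably
  additive, because clopen sets cannot decrease to the empty set without being empty from some index
  on. Caratheodory's theorem then extends it to the Borel sets.
\<close>
lemma clopen_content_extends:
  fixes \<nu> :: "(nat \<Rightarrow> 'a::{finite, discrete_topology}) set \<Rightarrow> real"
  assumes nonneg: "\<And>C. 0 \<le> \<nu> C" and total: "\<nu> UNIV = 1"
    and additive: "\<And>C D. C \<inter> D = {} \<Longrightarrow> \<nu> (C \<union> D) = \<nu> C + \<nu> D"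
  obtains \<mu> where "prob_space \<mu>" "sets \<mu> = sets borel"
    "\<And>C. open C \<Longrightarrow> closed C \<Longrightarrow> emeasure \<mu> C = ennreal (\<nu> C)"
proof -
  interpret algebra UNIV "clopens :: (nat \<Rightarrow> 'a) set set"
    unfolding algebra_iff_Un by (auto simp: closed_def Compl_eq_Diff_UNIV[symmetric])
  have empty: "\<nu> {} = 0" using additive[of "{}" "{}"] by simp
  have "\<exists>f. (\<forall>C\<in>clopens. f C = ennreal (\<nu> C)) \<and> measure_space UNIV (sigma_sets UNIV clopens) f"
  proof (rule caratheodory_empty_continuous)
    show "positive clopens (\<lambda>C. ennreal (\<nu> C))" by (simp add: positive_def empty)
    show "Measure_Space.additive clopens (\<lambda>C. ennreal (\<nu> C))"
      unfolding Measure_Space.additive_def by (simp add: additive ennreal_plus nonneg)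
    fix C :: "nat \<Rightarrow> (nat \<Rightarrow> 'a) set"
    assume C: "range C \<subseteq> clopens" "decseq C" "(\<Inter>i. C i) = {}"
    \<comment> \<open>By compactness a decreasing sequence of clopen sets with empty intersection is eventually
      empty, so continuity at the empty set costs nothing.\<close>
    have op: "open (- C i)" for i using C(1) by (auto simp: open_Compl)
    have cover: "UNIV \<subseteq> (\<Union>i\<in>UNIV. - C i)" using C(3) by auto
    obtain D where D: "finite D" "UNIV \<subseteq> (\<Union>i\<in>D. - C i)"
      by (rule compactE_image[OF compact_UNIV_sequences op cover])
    obtain k where k: "\<And>i. i \<in> D \<Longrightarrow> i \<le> k"
      using D(1) by (meson finite_nat_set_iff_bounded_le)
    have "C n = {}" if "n \<ge> k" for n
    proof -
      have "C n \<subseteq> C i" if "i \<in> D" for i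
        using C(2) k[OF that] \<open>n \<ge> k\<close> decseqD[of C i n] by auto
      with D(2) show ?thesis by blast
    qed
    then have "eventually (\<lambda>n. ennreal (\<nu> (C n)) = 0) sequentially"
      unfolding eventually_sequentially by (intro exI[of _ k]) (auto simp: empty)
    then show "(\<lambda>n. ennreal (\<nu> (C n))) \<longlonglongrightarrow> 0" by (rule tendsto_eventually)
  qed auto
  then obtain f where f: "\<And>C. C \<in> clopens \<Longrightarrow> f C = ennreal (\<nu> C)"
    "measure_space UNIV (sigma_sets UNIV clopens) f" by blast
  define \<mu> where "\<mu> = measure_of UNIV clopens f"
  have sets: "sets \<mu> = sets borel" by (simp add: \<mu>_def sets_borel_eq_clopens sets_measure_of)
  have val: "emeasure \<mu> C = ennreal (\<nu> C)" if "open C" "closed C" for C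
    using that f by (simp add: \<mu>_def emeasure_measure_of_conv sigma_sets.Basic)
  have "prob_space \<mu>"
    by (rule prob_spaceI) (simp add: \<mu>_def[symmetric] val total sets_eq_imp_space_eq[OF sets])
  then show thesis using sets val by (rule that)
qed

section \<open>Invariant limits of empirical measures\<close>

text \<open>
  Compactness of a product of unit intervals (Tychonoff) yields one filter along which all
  coordinates converge simultaneously. The index type is unrestricted, so the lemma applies to
  visit frequencies of all subsets at once; since limits along a filter respect linear
  relations, the limit values inherit finite additivity for free.
\<close>
lemma generalized_limit:
  fixes F :: "nat \<Rightarrow> 'b \<Rightarrow> real"
  assumes "\<And>k c. 0 \<le> F k c" "\<And>k c. F k c \<le> 1"
  obtains G \<nu> where "G \<noteq> bot" "G \<le> sequentially" "\<And>c. ((\<lambda>k. F k c) \<longlongrightarrow> \<nu> c) G"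
proof -
  define K :: "('b \<Rightarrow> real) set" where "K = PiE UNIV (\<lambda>_. {0..1})"
  have "compactin (product_topology (\<lambda>_. euclidean) UNIV) K"
    unfolding K_def by (subst compactin_PiE) auto
  then have "compact K" by (simp add: euclidean_product_topology)
  moreover have "filtermap F sequentially \<noteq> bot" by (simp add: filtermap_bot_iff)
  moreover have "eventually (\<lambda>f. f \<in> K) (filtermap F sequentially)"
    by (auto simp: eventually_filtermap K_def PiE_iff assms)
  ultimately obtain \<nu> where \<nu>: "inf (nhds \<nu>) (filtermap F sequentially) \<noteq> bot"
    unfolding compact_filter by blast
  define G where "G = inf sequentially (filtercomap F (nhds \<nu>))"
  have lim: "filterlim F (nhds \<nu>) G"
    unfolding G_def filterlim_iff_le_filtercomap by simp
  show thesis
  proof (rule that)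
    show "G \<noteq> bot"
    proof
      assume "G = bot"
      then obtain P Q where PQ: "eventually P sequentially" "eventually Q (nhds \<nu>)"
        "\<And>k. P k \<Longrightarrow> Q (F k) \<Longrightarrow> False"
        unfolding G_def trivial_limit_def eventually_inf eventually_filtercomap by blast
      have "eventually (\<lambda>f. \<exists>k. P k \<and> f = F k) (filtermap F sequentially)"
        using PQ(1) unfolding eventually_filtermap by (auto elim: eventually_mono)
      then have "eventually (\<lambda>_. False) (inf (nhds \<nu>) (filtermap F sequentially))"
        unfolding eventually_inf using PQ(2,3) by blast
      with \<nu> show False by (simp add: trivial_limit_def)
    qed
    show "G \<le> sequentially" by (simp add: G_def)
    show "((\<lambda>k. F k c) \<longlongrightarrow> \<nu> c) G" for c
      by (rule continuous_on_tendsto_compose[OF continuous_on_product_coordinates lim]) auto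
  qed
qed

text \<open>
  The mass of \<open>C\<close> under the empirical measure of the first \<open>n\<close> points of the orbit of \<open>x\<close>.
  Working with this function on all subsets, and with limits of it, postpones the construction of
  an actual measure until after the limit has been taken.
\<close>
definition visit_freq :: "(nat \<Rightarrow> 'a) \<Rightarrow> nat \<Rightarrow> (nat \<Rightarrow> 'a) set \<Rightarrow> real" where
  "visit_freq x n C = real (card {i. i < n \<and> (\<lambda>j. x (i + j)) \<in> C}) / real n"

lemma shift_space_tail: "shift_space X \<Longrightarrow> x \<in> X \<Longrightarrow> (\<lambda>j. x (i + j)) \<in> X"
proof (induction i)
  case (Suc i)
  have "shift_map (\<lambda>j. x (i + j)) \<in> X" using Suc unfolding shift_space_def by blast
  then show ?case by (simp add: shift_map_def)
qed simp

lemma card_less_Suc_if: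
  "card {i. i < Suc n \<and> P i} = card {i. i < n \<and> P i} + (if P n then 1 else 0)"
proof -
  have "{i. i < Suc n \<and> P i} = (if P n then insert n {i. i < n \<and> P i} else {i. i < n \<and> P i})"
    by (auto simp: less_Suc_eq)
  then show ?thesis by simp
qed

lemma card_shifted_condition:
  "card {i. i < n \<and> P (Suc i)} + (if P 0 then 1 else 0)
    = card {i. i < n \<and> P i} + (if P n then 1 else (0::nat))"
proof (induction n)
  case (Suc n)
  then show ?case unfolding card_less_Suc_if by (auto split: if_splits)
qed simp

lemma visit_freq_bounds: "0 \<le> visit_freq x n C" "visit_freq x n C \<le> 1"
proof -
  have "card {i. i < n \<and> (\<lambda>j. x (i + j)) \<in> C} \<le> card {..<n}" by (rule card_mono) auto
  then show "visit_freq x n C \<le> 1" by (cases "n = 0") (auto simp: visit_freq_def)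
qed (simp add: visit_freq_def)

lemma visit_freq_Un:
  assumes "C \<inter> D = {}"
  shows "visit_freq x n (C \<union> D) = visit_freq x n C + visit_freq x n D"
proof -
  have "{i. i < n \<and> (\<lambda>j. x (i + j)) \<in> C \<union> D}
    = {i. i < n \<and> (\<lambda>j. x (i + j)) \<in> C} \<union> {i. i < n \<and> (\<lambda>j. x (i + j)) \<in> D}" by auto
  moreover have "card \<dots> = card {i. i < n \<and> (\<lambda>j. x (i + j)) \<in> C} + card {i. i < n \<and> (\<lambda>j. x (i + j)) \<in> D}"
    using assms by (intro card_Un_disjoint) auto
  ultimately show ?thesis by (simp add: visit_freq_def add_divide_distrib)
qed

text \<open>
  Replacing \<open>C\<close> by its preimage moves the window of observed times by one, which changes only the
  contributions of the two end points. This is why limits of empirical measures are invariant.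
\<close>
lemma visit_freq_shift: "\<bar>visit_freq x n (shift_map -` C) - visit_freq x n C\<bar> \<le> 1 / real n"
proof -
  have "shift_map (\<lambda>j. x (i + j)) = (\<lambda>j. x (Suc i + j))" for i by (simp add: shift_map_def)
  then have "\<bar>real (card {i. i < n \<and> (\<lambda>j. x (i + j)) \<in> shift_map -` C})
      - real (card {i. i < n \<and> (\<lambda>j. x (i + j)) \<in> C})\<bar> \<le> 1"
    using card_shifted_condition[of n "\<lambda>i. (\<lambda>j. x (i + j)) \<in> C"] by (auto split: if_splits)
  then have "\<bar>real (card {i. i < n \<and> (\<lambda>j. x (i + j)) \<in> shift_map -` C})
      - real (card {i. i < n \<and> (\<lambda>j. x (i + j)) \<in> C})\<bar> / real n \<le> 1 / real n"
    by (intro divide_right_mono) auto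
  then show ?thesis by (simp add: visit_freq_def diff_divide_distrib[symmetric])
qed

lemma continuous_shift_map: "continuous_on UNIV (shift_map :: (nat \<Rightarrow> 'a::topological_space) \<Rightarrow> _)"
  unfolding shift_map_def by (intro continuous_on_coordinatewise_then_product continuous_on_product_coordinates)

text \<open>
  The Krylov--Bogoliubov argument. Starting points and window lengths both vary; the growing
  lengths are what makes the limit invariant. The limit measure lives on \<open>X\<close> because every
  cylinder disjoint from the closed invariant set \<open>X\<close> is never visited.
\<close>
lemma empirical_limit_measure:
  fixes X :: "(nat \<Rightarrow> 'a::{finite, discrete_topology}) set"
  assumes X: "shift_space X" and x: "\<And>k. x k \<in> X"
    and n: "filterlim n at_top sequentially"
  obtains \<mu> G where "\<mu> \<in> invariant_measures X" "G \<noteq> bot" "G \<le> sequentially"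
    "\<And>C. open C \<Longrightarrow> closed C \<Longrightarrow> ((\<lambda>k. visit_freq (x k) (n k) C) \<longlongrightarrow> measure \<mu> C) G"
proof -
  obtain G \<nu> where G: "G \<noteq> bot" "G \<le> sequentially"
    and \<nu>: "\<And>C. ((\<lambda>k. visit_freq (x k) (n k) C) \<longlongrightarrow> \<nu> C) G"
    using generalized_limit[of "\<lambda>k. visit_freq (x k) (n k)"] visit_freq_bounds by metis
  have npos: "eventually (\<lambda>k. n k > 0) G"
    by (rule filter_leD[OF G(2)]) (rule eventually_compose_filterlim[OF eventually_gt_at_top n])
  have full: "\<nu> C = 1" if "X \<subseteq> C" for C
  proof -
    have "(\<lambda>j. x k (i + j)) \<in> C" for k i using shift_space_tail[OF X x] that by blast
    then have "eventually (\<lambda>k. visit_freq (x k) (n k) C = 1) G"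
      using npos by (auto simp: visit_freq_def elim!: eventually_mono)
    then have "((\<lambda>k. visit_freq (x k) (n k) C) \<longlongrightarrow> 1) G" by (rule tendsto_eventually)
    with \<nu> show ?thesis by (rule tendsto_unique[OF G(1)])
  qed
  have add: "\<nu> (C \<union> D) = \<nu> C + \<nu> D" if "C \<inter> D = {}" for C D
  proof (rule tendsto_unique[OF G(1) \<nu>])
    show "((\<lambda>k. visit_freq (x k) (n k) (C \<union> D)) \<longlongrightarrow> \<nu> C + \<nu> D) G"
      unfolding visit_freq_Un[OF that] by (intro tendsto_add \<nu>)
  qed
  have nonneg: "0 \<le> \<nu> C" for C
    by (rule tendsto_lowerbound[OF \<nu> _ G(1)]) (simp add: visit_freq_bounds)
  have inv: "\<nu> (shift_map -` C) = \<nu> C" for C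
  proof -
    have "((\<lambda>k. visit_freq (x k) (n k) (shift_map -` C) - visit_freq (x k) (n k) C) \<longlongrightarrow> 0) G"
    proof (rule Lim_null_comparison)
      show "eventually (\<lambda>k. norm (visit_freq (x k) (n k) (shift_map -` C) - visit_freq (x k) (n k) C)
          \<le> 1 / real (n k)) G"
        using visit_freq_shift by (auto intro: always_eventually)
      have "((\<lambda>k. 1 / real (n k)) \<longlongrightarrow> 0) sequentially"
        using n by (intro tendsto_divide_0[OF tendsto_const] filterlim_at_top_imp_at_infinity
          filterlim_compose[OF filterlim_real_sequentially])
      then show "((\<lambda>k. 1 / real (n k)) \<longlongrightarrow> 0) G" using G(2) by (rule tendsto_mono[rotated])
    qed
    moreover have "((\<lambda>k. visit_freq (x k) (n k) (shift_map -` C) - visit_freq (x k) (n k) C)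
        \<longlongrightarrow> \<nu> (shift_map -` C) - \<nu> C) G" by (intro tendsto_diff \<nu>)
    ultimately show ?thesis using tendsto_unique[OF G(1)] by fastforce
  qed
  obtain \<mu> where \<mu>: "prob_space \<mu>" and sets: "sets \<mu> = sets borel"
    and val: "\<And>C. open C \<Longrightarrow> closed C \<Longrightarrow> emeasure \<mu> C = ennreal (\<nu> C)"
    using clopen_content_extends[of \<nu>] nonneg full[of UNIV] add by auto
  interpret prob_space \<mu> by fact
  have space: "space \<mu> = UNIV" using sets_eq_imp_space_eq[OF sets] by simp
  have meas: "shift_map \<in> measurable \<mu> borel"
    unfolding measurable_cong_sets[OF sets refl]
    by (rule borel_measurable_continuous_onI[OF continuous_shift_map])
  have "distr \<mu> borel shift_map = \<mu>"
  proof (rule measure_eqI_generator_eq[where E = clopens and \<Omega> = UNIV and A = "\<lambda>_. UNIV"])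
    fix C :: "(nat \<Rightarrow> 'a) set" assume C: "C \<in> clopens"
    then have "open (shift_map -` C)" "closed (shift_map -` C)"
      using continuous_shift_map by (auto intro: open_vimage closed_vimage)
    then show "emeasure (distr \<mu> borel shift_map) C = emeasure \<mu> C"
      using C by (subst emeasure_distr[OF meas]) (auto simp: val inv space)
  qed (auto simp: sets sets_borel_eq_clopens Int_stable_def emeasure_distr[OF meas] space)
  moreover have "emeasure \<mu> X = 1"
  proof -
    have op: "open (- X)" using X by (auto simp: shift_space_def)
    have "(\<Union>l\<in>{l. cylinder l \<subseteq> - X}. cylinder l) \<in> null_sets \<mu>"
    proof (rule null_sets_UN')
      fix l assume l: "l \<in> {l. cylinder l \<subseteq> - X}"
      have "\<nu> (cylinder l \<union> - cylinder l) = \<nu> (cylinder l) + \<nu> (- cylinder l)" by (rule add) auto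
      moreover have "\<nu> (- cylinder l) = 1" by (rule full) (use l in auto)
      ultimately have "\<nu> (cylinder l) = 0" using full[of UNIV] by simp
      then show "cylinder l \<in> null_sets \<mu>"
        by (intro null_setsI) (simp_all add: val clopen_cylinder sets)
    qed simp
    then have "emeasure \<mu> (- X) = 0"
      unfolding open_eq_Union_cylinders[OF op, symmetric] by (rule null_setsD1)
    then have "emeasure \<mu> (space \<mu> - X) = 0" by (simp add: space Compl_eq_Diff_UNIV)
    moreover have "X \<in> sets \<mu>" using X by (simp add: shift_space_def sets)
    ultimately show ?thesis
      using prob_compl[of X] by (simp add: emeasure_eq_measure)
  qed
  ultimately have "\<mu> \<in> invariant_measures X"
    using \<mu> sets by (simp add: invariant_measures_def)
  moreover have "((\<lambda>k. visit_freq (x k) (n k) C) \<longlongrightarrow> measure \<mu> C) G" if "open C" "closed C" for C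
    using \<nu>[of C] val[OF that] nonneg[of C] by (simp add: measure_def)
  ultimately show thesis using G by (intro that[of \<mu> G])
qed

text \<open>
  Uniformity comes from compactness: orbit segments of growing length that violate the bound would
  have a limiting invariant measure giving \<open>D\<close> mass at least \<open>\<delta>\<close>. That \<open>D\<close> is clopen is what lets
  its frequency pass to the limit.
\<close>
lemma uniformly_rare_visits:
  fixes X :: "(nat \<Rightarrow> 'a::{finite, discrete_topology}) set"
  assumes X: "shift_space X" and D: "open D" "closed D"
    and null: "\<And>\<mu>. \<mu> \<in> invariant_measures X \<Longrightarrow> measure \<mu> D = 0" and "\<delta> > 0"
  obtains N where "\<And>x n. x \<in> X \<Longrightarrow> n \<ge> N \<Longrightarrow> visit_freq x n D < \<delta>"
proof -
  have "\<exists>N. \<forall>x\<in>X. \<forall>n\<ge>N. visit_freq x n D < \<delta>"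
  proof (rule ccontr)
    assume "\<not> ?thesis"
    then have "\<forall>k. \<exists>x n. x \<in> X \<and> n \<ge> k \<and> visit_freq x n D \<ge> \<delta>" by (meson not_less)
    then obtain x n where xn: "\<And>k. x k \<in> X" "\<And>k. n k \<ge> k" "\<And>k. visit_freq (x k) (n k) D \<ge> \<delta>"
      by metis
    have lim: "filterlim n at_top sequentially"
      using xn(2) by (intro filterlim_at_top_mono[OF filterlim_ident]) auto
    obtain \<mu> G where \<mu>: "\<mu> \<in> invariant_measures X" "G \<noteq> bot" "G \<le> sequentially"
      "\<And>C. open C \<Longrightarrow> closed C \<Longrightarrow> ((\<lambda>k. visit_freq (x k) (n k) C) \<longlongrightarrow> measure \<mu> C) G"
      by (rule empirical_limit_measure[where x = x, OF X xn(1) lim]) blast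
    have "\<delta> \<le> measure \<mu> D"
      by (rule tendsto_lowerbound[OF \<mu>(4)[OF D] _ \<mu>(2)]) (simp add: xn(3))
    with null[OF \<mu>(1)] \<open>\<delta> > 0\<close> show False by simp
  qed
  then show thesis using that by blast
qed

section \<open>The Besicovitch distance\<close>

lemma dbar_le_of_count:
  assumes "\<And>n. real (card {j. j < n \<and> x j \<noteq> y j}) \<le> c * real n + K"
  shows "dbar x y \<le> ereal c"
proof -
  have "eventually (\<lambda>n. ereal (real (card {j. j < n \<and> x j \<noteq> y j}) / real n)
      \<le> ereal (c + K / real n)) sequentially"
    using eventually_gt_at_top[of 0]
  proof eventually_elim
    case (elim n)
    then show ?case using assms[of n] by (simp add: field_simps)
  qed
  then have "dbar x y \<le> limsup (\<lambda>n. ereal (c + K / real n))"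
    unfolding dbar_def by (rule Limsup_mono)
  also have "(\<lambda>n. c + K / real n) \<longlonglongrightarrow> c + 0"
    by (intro tendsto_add tendsto_const lim_const_over_n)
  then have "limsup (\<lambda>n. ereal (c + K / real n)) = ereal c"
    by (intro lim_imp_Limsup) auto
  finally show ?thesis .
qed

lemma dbar_triangle: "dbar x z \<le> dbar x y + dbar y z"
proof -
  let ?d = "\<lambda>x y n. ereal (real (card {j. j < n \<and> x j \<noteq> y j}) / real n)"
  have "?d x z n \<le> ?d x y n + ?d y z n" for n
  proof -
    have "card {j. j < n \<and> x j \<noteq> z j} \<le> card ({j. j < n \<and> x j \<noteq> y j} \<union> {j. j < n \<and> y j \<noteq> z j})"
      by (rule card_mono) auto
    also have "\<dots> \<le> card {j. j < n \<and> x j \<noteq> y j} + card {j. j < n \<and> y j \<noteq> z j}"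
      by (rule card_Un_le)
    finally have "real (card {j. j < n \<and> x j \<noteq> z j}) / real n
        \<le> real (card {j. j < n \<and> x j \<noteq> y j} + card {j. j < n \<and> y j \<noteq> z j}) / real n"
      by (intro divide_right_mono) auto
    then show ?thesis by (simp add: add_divide_distrib)
  qed
  then have "dbar x z \<le> limsup (\<lambda>n. ?d x y n + ?d y z n)"
    unfolding dbar_def by (intro Limsup_mono always_eventually allI)
  also have "\<dots> \<le> dbar x y + dbar y z"
    unfolding dbar_def by (rule ereal_limsup_add_mono)
  finally show ?thesis .
qed

section \<open>Concatenations as sequences with cut points\<close>

definition cut_sequence :: "(nat \<Rightarrow> nat) \<Rightarrow> bool" where
  "cut_sequence t \<longleftrightarrow> t 0 = 0 \<and> strict_mono t"

lemma inf_concat_segments: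
  assumes "cut_sequence t"
  shows "inf_concat (\<lambda>j. map z [t j..<t (Suc j)]) = z"
proof
  fix i
  have le: "t k \<le> t (Suc k)" for k
    using assms by (simp add: cut_sequence_def strict_mono_less_eq)
  have cat: "concat (map (\<lambda>j. map z [t j..<t (Suc j)]) [0..<k]) = map z [0..<t k]" for k
  proof (induction k)
    case 0
    then show ?case using assms by (simp add: cut_sequence_def)
  next
    case (Suc k)
    have "[0..<t (Suc k)] = [0..<t k] @ [t k..<t (Suc k)]"
      using upt_add_eq_append[of 0 "t k" "t (Suc k) - t k"] le[of k] by simp
    with Suc show ?case by simp
  qed
  have "Suc i \<le> t (Suc i)"
    using assms by (intro strict_mono_imp_increasing) (simp add: cut_sequence_def)
  then show "inf_concat (\<lambda>j. map z [t j..<t (Suc j)]) i = z i"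
    unfolding inf_concat_def cat by simp
qed

lemma word_eq_segment_inf_concat:
  fixes w :: "nat \<Rightarrow> 'a list"
  assumes "\<And>j. w j \<noteq> []"
  defines "t \<equiv> \<lambda>k::nat. \<Sum>i<k. length (w i)"
  shows "w j = map (inf_concat w) [t j..<t (Suc j)]"
proof (rule nth_equalityI)
  show "length (w j) = length (map (inf_concat w) [t j..<t (Suc j)])" by (simp add: t_def)
  have len: "length (concat (map w [0..<k])) = t k" for k
    by (induction k) (simp_all add: t_def)
  have stable: "concat (map w [0..<k']) ! i = concat (map w [0..<k]) ! i" if "i < t k" "k \<le> k'" for i k k'
    using \<open>k \<le> k'\<close>
  proof (induction k' rule: dec_induct)
    case (step n)
    have "t k \<le> t n" unfolding t_def by (rule sum_mono2) (use step in auto)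
    with \<open>i < t k\<close> step show ?case by (simp add: nth_append len)
  qed simp
  have ge: "k \<le> t k" for k
  proof (induction k)
    case (Suc k)
    have "length (w k) \<ge> 1" using assms(1)[of k] by (cases "w k") auto
    with Suc show ?case by (simp add: t_def)
  qed simp
  fix r assume r: "r < length (w j)"
  let ?i = "t j + r"
  have "inf_concat w ?i = concat (map w [0..<max (Suc ?i) (Suc j)]) ! ?i"
    unfolding inf_concat_def using ge[of "Suc ?i"] by (intro stable[symmetric]) auto
  also have "\<dots> = concat (map w [0..<Suc j]) ! ?i"
    using r by (intro stable) (auto simp: t_def)
  also have "\<dots> = w j ! r"
    using r by (simp add: nth_append len)
  finally show "w j ! r = map (inf_concat w) [t j..<t (Suc j)] ! r"
    using r by (simp add: t_def)
qed

text \<open>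
  Concatenations of words and sequences with marked cut points carry the same information. The
  second form is used below because cutting words into shorter blocks merely adds cut points,
  whereas concatenations would have to be flattened and re-indexed.
\<close>
lemma dbar_shadowing_iff_segments:
  fixes X :: "(nat \<Rightarrow> 'a) set"
  shows "dbar_shadowing X \<longleftrightarrow>
     (\<forall>\<epsilon>::real. \<epsilon> > 0 \<longrightarrow> (\<exists>N::nat. N > 0 \<and>
       (\<forall>z t. cut_sequence t \<longrightarrow> (\<forall>j. t j + N \<le> t (Suc j)) \<longrightarrow>
          (\<forall>j. map z [t j..<t (Suc j)] \<in> language X) \<longrightarrow> (\<exists>x\<in>X. dbar z x < ereal \<epsilon>))))"
  (is "_ \<longleftrightarrow> (\<forall>\<epsilon>. _ \<longrightarrow> (\<exists>N. _ \<and> ?segs \<epsilon> N))")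
proof -
  have "(\<forall>w. (\<forall>j. w j \<in> language X \<and> length (w j) \<ge> N) \<longrightarrow> (\<exists>x\<in>X. dbar (inf_concat w) x < ereal \<epsilon>))
      \<longleftrightarrow> ?segs \<epsilon> N" (is "?words \<longleftrightarrow> _") if "N > 0" for \<epsilon> N
  proof
    assume words: ?words
    show "?segs \<epsilon> N"
    proof (intro allI impI)
      fix z :: "nat \<Rightarrow> 'a" and t
      assume t: "cut_sequence t" "\<forall>j. t j + N \<le> t (Suc j)"
        "\<forall>j. map z [t j..<t (Suc j)] \<in> language X"
      have "N \<le> t (Suc j) - t j" for j using t(2)[rule_format, of j] by linarith
      with words[rule_format, of "\<lambda>j. map z [t j..<t (Suc j)]"] t(3)
      show "\<exists>x\<in>X. dbar z x < ereal \<epsilon>"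
        unfolding inf_concat_segments[OF t(1)] by simp
    qed
  next
    assume segs: "?segs \<epsilon> N"
    show ?words
    proof (intro allI impI)
      fix w :: "nat \<Rightarrow> 'a list"
      assume w: "\<forall>j. w j \<in> language X \<and> length (w j) \<ge> N"
      define t where "t = (\<lambda>k::nat. \<Sum>i<k. length (w i))"
      have pos: "length (w j) > 0" for j using w \<open>N > 0\<close> by (meson less_le_trans)
      then have "w j = map (inf_concat w) [t j..<t (Suc j)]" for j
        unfolding t_def by (intro word_eq_segment_inf_concat) auto
      moreover have "cut_sequence t"
        unfolding cut_sequence_def strict_mono_Suc_iff using pos by (simp add: t_def)
      moreover have "\<forall>j. t j + N \<le> t (Suc j)" using w by (simp add: t_def)
      ultimately show "\<exists>x\<in>X. dbar (inf_concat w) x < ereal \<epsilon>"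
        using segs w by metis
    qed
  qed
  then show ?thesis unfolding dbar_shadowing_def by (simp only: cong: conj_cong)
qed

section \<open>Refining cut points and replacing blocks\<close>

definition block_index :: "(nat \<Rightarrow> nat) \<Rightarrow> nat \<Rightarrow> nat" where
  "block_index t i = (LEAST k. i < t (Suc k))"

lemma block_index_bounds:
  assumes "cut_sequence t"
  shows "t (block_index t i) \<le> i" "i < t (Suc (block_index t i))"
proof -
  have "Suc i \<le> t (Suc i)"
    using assms by (intro strict_mono_imp_increasing) (simp add: cut_sequence_def)
  then have "i < t (Suc i)" by simp
  then show "i < t (Suc (block_index t i))" unfolding block_index_def by (rule LeastI)
  show "t (block_index t i) \<le> i"
  proof (cases "block_index t i")
    case 0
    then show ?thesis using assms by (simp add: cut_sequence_def)
  next
    case (Suc k)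
    then have "k < (LEAST k. i < t (Suc k))" by (simp add: block_index_def)
    from not_less_Least[OF this] Suc show ?thesis by simp
  qed
qed

lemma block_index_eqI:
  assumes "cut_sequence t" "t k \<le> i" "i < t (Suc k)"
  shows "block_index t i = k"
proof -
  have "t k < t (Suc (block_index t i))" "t (block_index t i) < t (Suc k)"
    using block_index_bounds[OF assms(1), of i] assms(2,3) by linarith+
  then show ?thesis using assms(1) by (simp add: cut_sequence_def strict_mono_less)
qed

text \<open>
  Each block of \<open>t\<close> is cut greedily into pieces of length \<open>m\<close>, stopping once fewer than \<open>2 * m\<close>
  positions remain; the remainder is kept as one last piece. Stopping early guarantees that no
  piece is shorter than \<open>m\<close>, and all cut points of \<open>t\<close> are kept.
\<close>
primrec refined_cuts :: "(nat \<Rightarrow> nat) \<Rightarrow> nat \<Rightarrow> nat \<Rightarrow> nat" where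
  "refined_cuts t m 0 = 0"
| "refined_cuts t m (Suc k) =
     (let p = refined_cuts t m k; e = t (Suc (block_index t p))
      in if p + 2 * m \<le> e then p + m else e)"

lemma refined_cuts_gap:
  assumes t: "cut_sequence t" and gap: "\<And>j. t j + m \<le> t (Suc j)"
  shows "refined_cuts t m k + m \<le> refined_cuts t m (Suc k)"
proof -
  \<comment> \<open>The greedy cutting never gets closer than \<open>m\<close> to the end of the current block.\<close>
  have inv: "refined_cuts t m k + m \<le> t (Suc (block_index t (refined_cuts t m k)))" for k
  proof (induction k)
    case 0
    have "block_index t 0 = 0"
      using t strict_monoD[of t 0 "Suc 0"] by (intro block_index_eqI) (auto simp: cut_sequence_def)
    then show ?case using gap[of 0] by simp
  next
    case (Suc k)
    define p where "p = refined_cuts t m k"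
    define j where "j = block_index t p"
    have pj: "t j \<le> p" "p < t (Suc j)" using block_index_bounds[OF t, of p] by (auto simp: j_def)
    show ?case
    proof (cases "p + 2 * m \<le> t (Suc j)")
      case True
      then have "refined_cuts t m (Suc k) = p + m" by (simp add: p_def j_def Let_def)
      moreover have "block_index t (p + m) = j" 
      proof (cases "m = 0")
        case False
        then show ?thesis using True pj by (intro block_index_eqI[OF t]) auto
      qed (simp add: j_def)
      ultimately show ?thesis using True by simp
    next
      case False
      then have "refined_cuts t m (Suc k) = t (Suc j)" by (simp add: p_def j_def Let_def)
      moreover have "block_index t (t (Suc j)) = Suc j"
        using t by (intro block_index_eqI) (auto simp: cut_sequence_def strict_mono_less)
      ultimately show ?thesis using gap[of "Suc j"] by simp
    qed
  qed
  show ?thesis using inv[of k] by (simp add: Let_def)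
qed

lemma cut_sequence_refined_cuts:
  assumes "cut_sequence t" "\<And>j. t j + m \<le> t (Suc j)" "m > 0"
  shows "cut_sequence (refined_cuts t m)"
  unfolding cut_sequence_def strict_mono_Suc_iff
proof (intro conjI allI)
  show "refined_cuts t m k < refined_cuts t m (Suc k)" for k
    using refined_cuts_gap[OF assms(1,2), of k] \<open>m > 0\<close> by linarith
qed simp

text \<open>
  A piece stays inside one original block. It has length exactly \<open>m\<close>, or else it is a
  last piece and all its positions lie within \<open>2 * m\<close> of the end of the original block.
\<close>
lemma refined_block_cases:
  fixes t m k
  defines "s \<equiv> refined_cuts t m"
  assumes t: "cut_sequence t" and j: "t j \<le> i" "i < t (Suc j)" and k: "s k \<le> i" "i < s (Suc k)"
  shows "t j \<le> s k \<and> (s (Suc k) = s k + m \<and> s k + m \<le> t (Suc j) \<or> t (Suc j) < i + 2 * m)"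
proof -
  define l where "l = block_index t (s k)"
  have step: "s (Suc k) = (if s k + 2 * m \<le> t (Suc l) then s k + m else t (Suc l))"
    by (simp add: s_def l_def Let_def)
  have l: "t l \<le> s k" "s k < t (Suc l)" using block_index_bounds[OF t] by (auto simp: l_def)
  have "i < t (Suc l)" using k step by (auto split: if_splits)
  then have "l = j" using l k j block_index_eqI[OF t, of l i] block_index_eqI[OF t, of j i] by simp
  then show ?thesis using step l k by (auto split: if_splits)
qed

text \<open>
  Blocks outside \<open>L\<close> are overwritten by words of \<open>L\<close> of the same length, so the cut points stay valid
  and only positions in bad blocks are affected.
\<close>
lemma replace_bad_blocks:
  assumes s: "cut_sequence s" and L: "\<And>n. u n \<in> L" "\<And>n. length (u n) = n"
  obtains z' where "\<And>k. map z' [s k..<s (Suc k)] \<in> L"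
    "\<And>k i. s k \<le> i \<Longrightarrow> i < s (Suc k) \<Longrightarrow> z' i \<noteq> z i \<Longrightarrow> map z [s k..<s (Suc k)] \<notin> L"
proof -
  define v where "v k = (if map z [s k..<s (Suc k)] \<in> L then map z [s k..<s (Suc k)]
      else u (s (Suc k) - s k))" for k
  define z' where "z' i = v (block_index s i) ! (i - s (block_index s i))" for i
  have z': "z' i = v k ! (i - s k)" if "s k \<le> i" "i < s (Suc k)" for i k
    using block_index_eqI[OF s that] by (simp add: z'_def)
  have "map z' [s k..<s (Suc k)] = v k" for k
  proof (rule nth_equalityI)
    show "length (map z' [s k..<s (Suc k)]) = length (v k)" by (simp add: v_def L)
    show "map z' [s k..<s (Suc k)] ! i = v k ! i" if "i < length (map z' [s k..<s (Suc k)])" for i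
      using that z'[of k "s k + i"] by simp
  qed
  then have "map z' [s k..<s (Suc k)] \<in> L" for k by (simp add: v_def L)
  moreover have "map z [s k..<s (Suc k)] \<notin> L" if "s k \<le> i" "i < s (Suc k)" "z' i \<noteq> z i" for k i
    using that z'[OF that(1,2)] by (auto simp: v_def)
  ultimately show thesis by (rule that)
qed

section \<open>Counting changed positions\<close>

text \<open>
  With \<open>B p\<close> saying that the block of length \<open>m\<close> starting at \<open>p\<close> is bad, this counts the positions
  near the end of the word or inside some bad block. Bad blocks are counted at every starting
  position, because visit frequencies bound exactly that number.
\<close>
lemma card_covered_by_blocks:
  assumes "r \<le> (L::nat)"
  shows "card {i. i < r \<and> (L < i + d \<or> (\<exists>p\<le>i. i < p + m \<and> B p))} \<le> d + m * card {p. p < r \<and> B p}"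
proof -
  have "{i. i < r \<and> (L < i + d \<or> (\<exists>p\<le>i. i < p + m \<and> B p))}
      \<subseteq> {L - d..<L} \<union> (\<lambda>(q, p). p + q) ` ({..<m} \<times> {p. p < r \<and> B p})" (is "_ \<subseteq> ?tail \<union> ?blocks")
  proof
    fix i assume i: "i \<in> {i. i < r \<and> (L < i + d \<or> (\<exists>p\<le>i. i < p + m \<and> B p))}"
    show "i \<in> ?tail \<union> ?blocks"
    proof (cases "L < i + d")
      case True
      then show ?thesis using i assms by auto
    next
      case False
      then obtain p where "p \<le> i" "i < p + m" "B p" using i by blast
      then have "i = (\<lambda>(q, p). p + q) (i - p, p)" "(i - p, p) \<in> {..<m} \<times> {p. p < r \<and> B p}"
        using i by auto
      then show ?thesis by blast
    qed
  qed
  then have "card {i. i < r \<and> (L < i + d \<or> (\<exists>p\<le>i. i < p + m \<and> B p))} \<le> card (?tail \<union> ?blocks)"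
    by (intro card_mono) auto
  also have "\<dots> \<le> card ?tail + card ?blocks" by (rule card_Un_le)
  also have "card ?blocks \<le> card ({..<m} \<times> {p. p < r \<and> B p})" by (rule card_image_le) auto
  also have "card ?tail + card ({..<m} \<times> {p. p < r \<and> B p}) \<le> d + m * card {p. p < r \<and> B p}" by simp
  finally show ?thesis by simp
qed

lemma card_split_at:
  fixes a r :: nat
  shows "card {i. i < a + r \<and> P i} = card {i. i < a \<and> P i} + card {i. i < r \<and> P (a + i)}"
proof -
  have "{i. i < a + r \<and> P i} = {i. i < a \<and> P i} \<union> (\<lambda>i. a + i) ` {i. i < r \<and> P (a + i)}"
    (is "_ = ?A \<union> ?B")
  proof (intro equalityI subsetI)
    fix i assume i: "i \<in> {i. i < a + r \<and> P i}"
    show "i \<in> ?A \<union> ?B"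
    proof (cases "i < a")
      case False
      then have "i = a + (i - a)" "i - a \<in> {i. i < r \<and> P (a + i)}" using i by auto
      then show ?thesis by blast
    qed (use i in auto)
  qed auto
  moreover have "card (?A \<union> ?B) = card ?A + card ?B" by (intro card_Un_disjoint) auto
  moreover have "card ?B = card {i. i < r \<and> P (a + i)}" by (intro card_image) auto
  ultimately show ?thesis by simp
qed

text \<open>
  The additive error \<open>K\<close> occurs once per block. When blocks are long compared with \<open>K\<close>, the errors of
  the completed blocks are absorbed into the linear term, and only the last, incomplete block
  contributes \<open>K\<close> itself.
\<close>
lemma count_by_blocks:
  fixes c c' K :: real
  assumes t: "cut_sequence t"
    and blocks: "\<And>j r. r \<le> t (Suc j) - t j \<Longrightarrow> real (card {i. i < r \<and> P (t j + i)}) \<le> c * real r + K"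
    and K: "\<And>j. K \<le> c' * real (t (Suc j) - t j)" and "c' \<ge> 0"
  shows "real (card {i. i < n \<and> P i}) \<le> (c + c') * real n + K"
proof -
  have lt: "t j < t (Suc j)" for j using t by (simp add: cut_sequence_def strict_mono_less)
  have full: "real (card {i. i < t j \<and> P i}) \<le> (c + c') * real (t j)" for j
  proof (induction j)
    case (Suc j)
    have e: "t (Suc j) = t j + (t (Suc j) - t j)" using lt[of j] by simp
    have "real (card {i. i < t j + (t (Suc j) - t j) \<and> P i})
        = real (card {i. i < t j \<and> P i}) + real (card {i. i < t (Suc j) - t j \<and> P (t j + i)})"
      by (simp only: card_split_at of_nat_add)
    also have "\<dots> \<le> (c + c') * real (t j) + (c * real (t (Suc j) - t j) + c' * real (t (Suc j) - t j))"
      using Suc blocks[of "t (Suc j) - t j" j] K[of j] by linarith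
    also have "\<dots> = (c + c') * real (t j + (t (Suc j) - t j))"
      by (simp only: of_nat_add) (simp add: algebra_simps)
    finally show ?case using e by simp
  qed (use t in \<open>simp add: cut_sequence_def\<close>)
  define j where "j = block_index t n"
  define r where "r = n - t j"
  have n: "n = t j + r" "r \<le> t (Suc j) - t j"
    using block_index_bounds[OF t, of n] by (auto simp: j_def r_def)
  have "real (card {i. i < n \<and> P i})
      = real (card {i. i < t j \<and> P i}) + real (card {i. i < r \<and> P (t j + i)})"
    unfolding n(1) card_split_at by simp
  also have "\<dots> \<le> (c + c') * real (t j) + (c * real r + K)"
    using full[of j] blocks[OF n(2)] by linarith
  also have "\<dots> \<le> (c + c') * real (t j) + ((c + c') * real r + K)"
    using \<open>c' \<ge> 0\<close> by (simp add: distrib_right)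
  also have "\<dots> = (c + c') * real n + K" using n(1) by (simp add: algebra_simps)
  finally show ?thesis .
qed

section \<open>Shadowing from a subshift of full measure\<close>

lemma map_upt_in_language: "x \<in> X \<Longrightarrow> map x [i..<i + n] \<in> language X"
  by (auto simp: language_def)

lemma map_upt_tail: "map (\<lambda>j. x (p + j)) [0..<m] = map x [p..<p + m]"
  by (rule nth_equalityI) auto

lemma language_prefix_of_point:
  assumes "shift_space X" "w \<in> language X"
  obtains x where "x \<in> X" "w = map x [0..<length w]"
proof -
  obtain y i n where y: "y \<in> X" "w = map y [i..<i + n]"
    using assms(2) by (auto simp: language_def)
  show thesis
  proof (rule that)
    show "(\<lambda>j. y (i + j)) \<in> X" by (rule shift_space_tail[OF assms(1) y(1)])
    show "w = map (\<lambda>j. y (i + j)) [0..<length w]" using y(2) by (simp add: map_upt_tail)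
  qed
qed

text \<open>
  Points whose first \<open>m\<close> symbols are not a word of \<open>Y\<close> form a clopen set disjoint from \<open>Y\<close>, so every
  invariant measure on \<open>X\<close> ignores it.
\<close>
lemma foreign_blocks_rare:
  fixes X Y :: "(nat \<Rightarrow> 'a::{finite, discrete_topology}) set"
  assumes X: "shift_space X" and Y: "full_measure_subshift X Y" and "\<delta> > 0"
  obtains N where "\<And>x n. x \<in> X \<Longrightarrow> n \<ge> N \<Longrightarrow>
    real (card {p. p < n \<and> map x [p..<p + m] \<notin> language Y}) \<le> \<delta> * real n"
proof -
  define D where "D = {y::nat \<Rightarrow> 'a. map y [0..<m] \<in> - language Y}"
  have D: "open D" "closed D" unfolding D_def by (rule clopen_prefix_condition)+
  have disj: "D \<inter> Y = {}" using map_upt_in_language[of _ Y 0 m] by (auto simp: D_def)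
  have null: "measure \<mu> D = 0" if \<mu>: "\<mu> \<in> invariant_measures X" for \<mu>
  proof -
    interpret prob_space \<mu> using \<mu> by (simp add: invariant_measures_def)
    have sets: "sets \<mu> = sets borel" using \<mu> by (simp add: invariant_measures_def)
    have Ys: "Y \<in> sets \<mu>" using Y by (simp add: full_measure_subshift_def shift_space_def sets)
    have "emeasure \<mu> Y = 1" using Y \<mu> by (simp add: full_measure_subshift_def)
    then have "measure \<mu> Y = 1" by (simp add: measure_def)
    then have "measure \<mu> (space \<mu> - Y) = 0" by (simp add: prob_compl[OF Ys])
    moreover have "measure \<mu> D \<le> measure \<mu> (space \<mu> - Y)"
      using disj sets.compl_sets[OF Ys] sets_eq_imp_space_eq[OF sets] by (intro finite_measure_mono) auto
    ultimately show ?thesis using measure_nonneg[of \<mu> D] by linarith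
  qed
  obtain N where N: "\<And>x n. x \<in> X \<Longrightarrow> n \<ge> N \<Longrightarrow> visit_freq x n D < \<delta>"
    using uniformly_rare_visits[OF X D null \<open>\<delta> > 0\<close>] by blast
  show thesis
  proof (rule that)
    fix x n assume "x \<in> X" "n \<ge> N"
    from N[OF this] show "real (card {p. p < n \<and> map x [p..<p + m] \<notin> language Y}) \<le> \<delta> * real n"
      by (cases "n = 0") (auto simp: visit_freq_def D_def map_upt_tail field_simps)
  qed
qed

text \<open>
  Long words of \<open>X\<close> are nearly concatenations of words of \<open>Y\<close> of length at least \<open>m\<close>. Cut each word
  into pieces of length between \<open>m\<close> and \<open>2 * m\<close> and overwrite the pieces that are foreign to \<open>Y\<close>.
  Within one word this costs at most \<open>m\<close> positions per foreign block, which is a small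
  proportion, and at most \<open>2 * m\<close> positions at the end of the word, which is negligible when the
  word is long.
\<close>
lemma approximate_by_subshift_blocks:
  fixes X Y :: "(nat \<Rightarrow> 'a::{finite, discrete_topology}) set"
  assumes X: "shift_space X" and Y: "full_measure_subshift X Y" and "m > 0" "\<eta> > 0"
  obtains N where "N > 0"
    "\<And>z t. cut_sequence t \<Longrightarrow> (\<And>j. t j + N \<le> t (Suc j)) \<Longrightarrow>
       (\<And>j. map z [t j..<t (Suc j)] \<in> language X) \<Longrightarrow>
       \<exists>z' s. cut_sequence s \<and> (\<forall>k. s k + m \<le> s (Suc k)) \<and>
         (\<forall>k. map z' [s k..<s (Suc k)] \<in> language Y) \<and> dbar z z' \<le> ereal \<eta>"
proof -
  \<comment> \<open>Each foreign block spoils up to \<open>m\<close> positions, so this density costs \<open>\<eta> / 2\<close>; the other half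
    pays for the errors at the ends of words.\<close>
  define \<delta> where "\<delta> = \<eta> / (2 * real m)"
  have "\<delta> > 0" using \<open>m > 0\<close> \<open>\<eta> > 0\<close> by (simp add: \<delta>_def)
  obtain N\<^sub>1 where N\<^sub>1: "\<And>x n. x \<in> X \<Longrightarrow> n \<ge> N\<^sub>1 \<Longrightarrow>
      real (card {p. p < n \<and> map x [p..<p + m] \<notin> language Y}) \<le> \<delta> * real n"
    using foreign_blocks_rare[OF X Y \<open>\<delta> > 0\<close>, where m = m] by blast
  \<comment> \<open>Besides the last \<open>2 * m\<close> positions of a word, an initial segment shorter than \<open>N\<^sub>1\<close> is counted as
    if all its blocks were foreign, because the frequency bound does not apply to it.\<close>
  define K where "K = real (m * N\<^sub>1 + 2 * m)"
  define N where "N = m + nat \<lceil>2 * K / \<eta>\<rceil>"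
  have "2 * K / \<eta> \<le> real N" unfolding N_def using of_nat_ceiling[of "2 * K / \<eta>"] by simp
  then have K_le: "K \<le> \<eta> / 2 * real N" using \<open>\<eta> > 0\<close> by (simp add: field_simps)
  obtain y where "y \<in> Y" using Y by (auto simp: full_measure_subshift_def shift_space_def)
  then have u: "map y [0..<n] \<in> language Y" for n
    using map_upt_in_language[of y Y 0 n] by simp
  show thesis
  proof (rule that)
    show "N > 0" using \<open>m > 0\<close> by (simp add: N_def)
    fix z :: "nat \<Rightarrow> 'a" and t
    assume t: "cut_sequence t" and gap: "\<And>j. t j + N \<le> t (Suc j)"
      and words: "\<And>j. map z [t j..<t (Suc j)] \<in> language X"
    have gap_m: "t j + m \<le> t (Suc j)" for j using gap[of j] by (simp add: N_def)
    define s where "s = refined_cuts t m"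
    have s: "cut_sequence s" and s_gap: "\<forall>k. s k + m \<le> s (Suc k)"
      using cut_sequence_refined_cuts[OF t gap_m \<open>m > 0\<close>] refined_cuts_gap[OF t gap_m]
      by (auto simp: s_def)
    obtain z' where z': "\<And>k. map z' [s k..<s (Suc k)] \<in> language Y"
      and differ: "\<And>k i. s k \<le> i \<Longrightarrow> i < s (Suc k) \<Longrightarrow> z' i \<noteq> z i \<Longrightarrow>
        map z [s k..<s (Suc k)] \<notin> language Y"
      using replace_bad_blocks[OF s, of "\<lambda>n. map y [0..<n]" "language Y" z] u by auto
    have blocks: "real (card {i. i < r \<and> z (t j + i) \<noteq> z' (t j + i)}) \<le> \<eta> / 2 * real r + K"
      if r: "r \<le> t (Suc j) - t j" for j r
    proof -
      define L where "L = t (Suc j) - t j"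
      obtain x where x: "x \<in> X" "map z [t j..<t (Suc j)] = map x [0..<L]"
        using language_prefix_of_point[OF X words[of j]] by (auto simp: L_def)
      have zx: "z (t j + i) = x i" if "i < L" for i
        using arg_cong[OF x(2), of "\<lambda>w. w ! i"] that by (simp add: L_def)
      define B where "B p = (map x [p..<p + m] \<notin> language Y)" for p
      have "{i. i < r \<and> z (t j + i) \<noteq> z' (t j + i)}
          \<subseteq> {i. i < r \<and> (L < i + 2 * m \<or> (\<exists>p\<le>i. i < p + m \<and> B p))}"
      proof safe
        fix i assume i: "i < r" "z (t j + i) \<noteq> z' (t j + i)" "\<not> (\<exists>p\<le>i. i < p + m \<and> B p)"
        have iL: "t j + i < t (Suc j)" using i(1) r by linarith
        define k where "k = block_index s (t j + i)"
        have k: "s k \<le> t j + i" "t j + i < s (Suc k)"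
          using block_index_bounds[OF s] by (auto simp: k_def)
        have bad: "map z [s k..<s (Suc k)] \<notin> language Y" using differ[OF k] i(2) by simp
        show "L < i + 2 * m"
        proof (rule ccontr)
          assume "\<not> L < i + 2 * m"
          then have p: "t j \<le> s k" "s (Suc k) = s k + m" "s k + m \<le> t (Suc j)"
            using refined_block_cases[OF t le_add1 iL, of m k, folded s_def] k iL
            by (auto simp: L_def)
          \<comment> \<open>The piece lies in the word with number \<open>j\<close>, so it is a foreign block of \<open>x\<close>.\<close>
          define p where "p = s k - t j"
          have "map z [s k..<s (Suc k)] = map x [p..<p + m]"
            by (rule nth_equalityI)
              (use p zx[of "p + _"] in \<open>auto simp: p_def L_def\<close>)
          then have "B p" using bad by (simp add: B_def)
          moreover have "p \<le> i" "i < p + m" using k p by (auto simp: p_def)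
          ultimately show False using i(3) by blast
        qed
      qed
      then have "card {i. i < r \<and> z (t j + i) \<noteq> z' (t j + i)}
          \<le> card {i. i < r \<and> (L < i + 2 * m \<or> (\<exists>p\<le>i. i < p + m \<and> B p))}"
        by (intro card_mono) auto
      also have "\<dots> \<le> 2 * m + m * card {p. p < r \<and> B p}"
        using r by (intro card_covered_by_blocks) (simp add: L_def)
      finally have "real (card {i. i < r \<and> z (t j + i) \<noteq> z' (t j + i)})
          \<le> 2 * real m + real m * real (card {p. p < r \<and> B p})"
        using of_nat_mono by fastforce
      also have "real (card {p. p < r \<and> B p}) \<le> \<delta> * real r + real N\<^sub>1"
      proof (cases "r \<ge> N\<^sub>1")
        case True
        then show ?thesis using N\<^sub>1[OF x(1) True] by (simp add: B_def)
      next
        case False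
        have "card {p. p < r \<and> B p} \<le> card {..<r}" by (intro card_mono) auto
        then have "real (card {p. p < r \<and> B p}) \<le> real N\<^sub>1" using False by simp
        moreover have "0 \<le> \<delta> * real r" using \<open>\<delta> > 0\<close> by simp
        ultimately show ?thesis by linarith
      qed
      then have "2 * real m + real m * real (card {p. p < r \<and> B p})
          \<le> 2 * real m + real m * (\<delta> * real r + real N\<^sub>1)"
        by (intro add_left_mono mult_left_mono) auto
      also have "\<dots> = \<eta> / 2 * real r + K"
        using \<open>m > 0\<close> by (simp add: \<delta>_def K_def field_simps)
      finally show ?thesis .
    qed
    have K: "K \<le> \<eta> / 2 * real (t (Suc j) - t j)" for j
    proof -
      have "real N \<le> real (t (Suc j) - t j)" using gap[of j] by simp
      then have "\<eta> / 2 * real N \<le> \<eta> / 2 * real (t (Suc j) - t j)"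
        using \<open>\<eta> > 0\<close> by (intro mult_left_mono) auto
      with K_le show ?thesis by linarith
    qed
    have "real (card {i. i < n \<and> z i \<noteq> z' i}) \<le> (\<eta> / 2 + \<eta> / 2) * real n + K" for n
      using \<open>\<eta> > 0\<close> by (intro count_by_blocks[OF t blocks K]) auto
    then have "dbar z z' \<le> ereal \<eta>" using dbar_le_of_count[of z z' \<eta> K] by simp
    with s s_gap z' show "\<exists>z' s. cut_sequence s \<and> (\<forall>k. s k + m \<le> s (Suc k)) \<and>
        (\<forall>k. map z' [s k..<s (Suc k)] \<in> language Y) \<and> dbar z z' \<le> ereal \<eta>" by blast
  qed
qed

theorem theorem17:
  fixes X Xplus :: "(nat \<Rightarrow> 'a::{finite, discrete_topology}) set"
  assumes "CARD('a) \<ge> 2"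
    and "shift_space X"
    and "is_measure_center X Xplus"
    and "dbar_shadowing Xplus"
  shows "dbar_shadowing X"
  unfolding dbar_shadowing_iff_segments
proof (intro allI impI)
  fix \<epsilon> :: real assume "\<epsilon> > 0"
  then have "\<epsilon> / 2 > 0" by simp
  then obtain m where "m > 0" and shadow: "\<And>z t. cut_sequence t \<Longrightarrow> (\<forall>j. t j + m \<le> t (Suc j)) \<Longrightarrow>
      (\<forall>j. map z [t j..<t (Suc j)] \<in> language Xplus) \<Longrightarrow> \<exists>x\<in>Xplus. dbar z x < ereal (\<epsilon> / 2)"
    using assms(4) unfolding dbar_shadowing_iff_segments by meson
  have full: "full_measure_subshift X Xplus" using assms(3) by (simp add: is_measure_center_def)
  obtain N where "N > 0" and approx: "\<And>z t. cut_sequence t \<Longrightarrow> (\<And>j. t j + N \<le> t (Suc j)) \<Longrightarrow>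
      (\<And>j. map z [t j..<t (Suc j)] \<in> language X) \<Longrightarrow>
      \<exists>z' s. cut_sequence s \<and> (\<forall>k. s k + m \<le> s (Suc k)) \<and>
        (\<forall>k. map z' [s k..<s (Suc k)] \<in> language Xplus) \<and> dbar z z' \<le> ereal (\<epsilon> / 2)"
    by (rule approximate_by_subshift_blocks[OF assms(2) full \<open>m > 0\<close> \<open>\<epsilon> / 2 > 0\<close>]) blast
  have "\<exists>x\<in>X. dbar z x < ereal \<epsilon>"
    if segs: "cut_sequence t" "\<forall>j. t j + N \<le> t (Suc j)" "\<forall>j. map z [t j..<t (Suc j)] \<in> language X"
    for z t
  proof -
    obtain z' s where "cut_sequence s" "\<forall>k. s k + m \<le> s (Suc k)"
      "\<forall>k. map z' [s k..<s (Suc k)] \<in> language Xplus" and near: "dbar z z' \<le> ereal (\<epsilon> / 2)"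
      using approx[of t z] segs by blast
    then obtain x where "x \<in> Xplus" "dbar z' x < ereal (\<epsilon> / 2)" using shadow by blast
    have "dbar z x \<le> ereal (\<epsilon> / 2) + dbar z' x"
      using dbar_triangle[of z x z'] add_right_mono[OF near] by (rule order_trans)
    also have "\<dots> < ereal (\<epsilon> / 2) + ereal (\<epsilon> / 2)"
      using \<open>dbar z' x < ereal (\<epsilon> / 2)\<close> by (intro ereal_less_add) auto
    finally have "dbar z x < ereal \<epsilon>" by simp
    moreover have "x \<in> X" using \<open>x \<in> Xplus\<close> full by (auto simp: full_measure_subshift_def)
    ultimately show ?thesis by blast
  qed
  with \<open>N > 0\<close> show "\<exists>N>0. \<forall>z t. cut_sequence t \<longrightarrow> (\<forall>j. t j + N \<le> t (Suc j)) \<longrightarrow>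
      (\<forall>j. map z [t j..<t (Suc j)] \<in> language X) \<longrightarrow> (\<exists>x\<in>X. dbar z x < ereal \<epsilon>)" by blast
qed

end
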